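(* Any cluster variable $x_w$ is completely determined by any one of its monomials: if two cluster variables of a type $A$ polygon cluster algebra, written as Laurent polynomials with respect to the same initial seed, have a Laurent monomial in common, then they are equal.
   Context: The type $A_n$ polygon cluster algebra has as initial seed a triangulation of an $(n+3)$-gon: initial cluster variables $x_1,\dots,x_n$ correspond to the internal diagonals and frozen variables $x_{n+1},\dots,x_{2n+3}$ to the boundary segments; the quiver has clockwise $3$-cycles inside each triangle. Its cluster variables correspond to the arcs of the polygon, and flips of diagonals correspond to seed mutations. Each cluster variable is a Laurent polynomial in the initial variables; the monomials of a cluster variable are the Laurent monomials occurring in this expansion. Each such cluster variable is $x_w$ for a word $w$ over $\{a,b\}$, namely the variable of an arc crossing all diagonals of the triangulated subpolygon consisting of the triangles it passes through. *)

theory Defs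
  imports
    "HOL-Library.Poly_Mapping"
    "HOL-Computational_Algebra.Fraction_Field"
begin

text \<open>A quiver on labelled vertices is given by its arrow multiplicities: \<open>q i j\<close> is the
  number of arrows from \<open>i\<close> to \<open>j\<close>.\<close>

type_synonym quiver = "nat \<Rightarrow> nat \<Rightarrow> nat"

text \<open>Mutation at \<open>k\<close> adds an arrow from \<open>i\<close> to \<open>j\<close> for every path through \<open>k\<close>, reverses the
  arrows at \<open>k\<close> and then cancels oriented 2-cycles; the truncated subtraction on \<open>nat\<close>
  is exactly this cancellation.\<close>

definition mutate_quiver :: "nat \<Rightarrow> quiver \<Rightarrow> quiver" where
  "mutate_quiver k q = (\<lambda>i j.
     if i = k \<or> j = k then q j i
     else (q i j + q i k * q k j) - (q j i + q j k * q k i))"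

type_synonym 'f seed = "(nat \<Rightarrow> 'f) \<times> quiver"

text \<open>Extended clusters are indexed by \<open>{1..m}\<close>. The labels \<open>{1..n}\<close> are mutable and
  \<open>{n+1..m}\<close> are frozen; values at other labels are irrelevant.\<close>

definition mutate_seed :: "nat \<Rightarrow> nat \<Rightarrow> 'f::field seed \<Rightarrow> 'f seed" where
  "mutate_seed m k = (\<lambda>(x, q).
     (x(k := ((\<Prod>i\<in>{1..m}. x i ^ q i k) + (\<Prod>i\<in>{1..m}. x i ^ q k i)) / x k),
      mutate_quiver k q))"

inductive_set seeds :: "nat \<Rightarrow> nat \<Rightarrow> 'f::field seed \<Rightarrow> 'f seed set"
  for n m :: nat and s0 :: "'f::field seed" where
  initial: "s0 \<in> seeds n m s0"
| mutate: "s \<in> seeds n m s0 \<Longrightarrow> k \<in> {1..n} \<Longrightarrow> mutate_seed m k s \<in> seeds n m s0"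

definition cluster_variables :: "nat \<Rightarrow> nat \<Rightarrow> 'f::field seed \<Rightarrow> 'f set" where
  "cluster_variables n m s0 = {fst s k | s k. s \<in> seeds n m s0 \<and> k \<in> {1..n}}"

text \<open>Laurent polynomials over the integers in variables \<open>x\<^sub>0, x\<^sub>1, \<dots>\<close>: finitely
  supported functions on exponent vectors. Their field of fractions is the ambient field of
  rational functions. Only the variables occurring in a given seed play a role.\<close>

type_synonym laurent_monomial = "nat \<Rightarrow>\<^sub>0 int"
type_synonym laurent = "laurent_monomial \<Rightarrow>\<^sub>0 int"
type_synonym ratfun = "laurent fract"

definition of_laurent :: "laurent \<Rightarrow> ratfun" where
  "of_laurent p = Fraction_Field.Fract p 1"

definition var :: "nat \<Rightarrow> ratfun" where
  "var i = of_laurent (Poly_Mapping.single (Poly_Mapping.single i 1) 1)"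

text \<open>Only meaningful for elements of the image of \<open>of_laurent\<close>; by the Laurent phenomenon
  these include all cluster variables.\<close>

definition laurent_expansion :: "ratfun \<Rightarrow> laurent" where
  "laurent_expansion u = (THE p. of_laurent p = u)"

definition laurent_monomials :: "ratfun \<Rightarrow> laurent_monomial set" where
  "laurent_monomials u = Poly_Mapping.keys (laurent_expansion u)"

lemma of_laurent_eq_iff [simp]: "of_laurent p = of_laurent p' \<longleftrightarrow> p = p'"
  by (simp add: of_laurent_def eq_fract)

lemma laurent_expansion_of_laurent [simp]: "laurent_expansion (of_laurent p) = p"
  by (simp add: laurent_expansion_def)

text \<open>The vertices of the \<open>(n+3)\<close>-gon are \<open>0, \<dots>, n+2\<close> in clockwise order. A segment
  joining two vertices is the pair of its endpoints, the smaller one first.\<close>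

type_synonym segment = "nat \<times> nat"

definition boundary_segments :: "nat \<Rightarrow> segment set" where
  "boundary_segments n = {(a, a + 1) | a. a + 1 < n + 3} \<union> {(0, n + 2)}"

definition diagonals :: "nat \<Rightarrow> segment set" where
  "diagonals n = {(a, b). a < b \<and> b < n + 3} - boundary_segments n"

definition crosses :: "segment \<Rightarrow> segment \<Rightarrow> bool" where
  "crosses = (\<lambda>(a, b) (c, d). a < c \<and> c < b \<and> b < d \<or> c < a \<and> a < d \<and> d < b)"

definition noncrossing :: "segment set \<Rightarrow> bool" where
  "noncrossing T \<longleftrightarrow> (\<forall>e\<in>T. \<forall>f\<in>T. \<not> crosses e f)"

definition triangulation :: "nat \<Rightarrow> segment set \<Rightarrow> bool" where
  "triangulation n T \<longleftrightarrow> T \<subseteq> diagonals n \<and> noncrossing T \<and>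
     (\<forall>T'. T \<subseteq> T' \<and> T' \<subseteq> diagonals n \<and> noncrossing T' \<longrightarrow> T' = T)"

text \<open>Going clockwise around a triangle \<open>a < b < c\<close> of the triangulation, the sides are met in
  the cyclic order \<open>(a, b)\<close>, \<open>(b, c)\<close>, \<open>(a, c)\<close>. Three pairwise adjacent vertices of a
  triangulated polygon always bound a triangle of the triangulation.\<close>

definition triangles :: "nat \<Rightarrow> segment set \<Rightarrow> (nat \<times> nat \<times> nat) set" where
  "triangles n T = {(a, b, c). a < b \<and> b < c \<and>
     {(a, b), (b, c), (a, c)} \<subseteq> T \<union> boundary_segments n}"

definition clockwise_cycle :: "nat \<times> nat \<times> nat \<Rightarrow> (segment \<times> segment) set" where
  "clockwise_cycle = (\<lambda>(a, b, c).
     {((a, b), (b, c)), ((b, c), (a, c)), ((a, c), (a, b))})"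

text \<open>The function \<open>d\<close> labels the diagonals of \<open>T\<close> by \<open>{1..n}\<close> and the boundary segments by
  \<open>{n+1..2*n+3}\<close>.\<close>

definition labelling :: "nat \<Rightarrow> segment set \<Rightarrow> (nat \<Rightarrow> segment) \<Rightarrow> bool" where
  "labelling n T d \<longleftrightarrow> bij_betw d {1..n} T \<and>
     bij_betw d {n + 1..2 * n + 3} (boundary_segments n)"

definition polygon_quiver :: "nat \<Rightarrow> segment set \<Rightarrow> (nat \<Rightarrow> segment) \<Rightarrow> quiver" where
  "polygon_quiver n T d = (\<lambda>i j.
     if i \<in> {1..2 * n + 3} \<and> j \<in> {1..2 * n + 3}
     then card {t \<in> triangles n T. (d i, d j) \<in> clockwise_cycle t} else 0)"

definition polygon_seed :: "nat \<Rightarrow> segment set \<Rightarrow> (nat \<Rightarrow> segment) \<Rightarrow> ratfun seed" where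
  "polygon_seed n T d = (var, polygon_quiver n T d)"

definition polygon_cluster_variables ::
    "nat \<Rightarrow> segment set \<Rightarrow> (nat \<Rightarrow> segment) \<Rightarrow> ratfun set" where
  "polygon_cluster_variables n T d = cluster_variables n (2 * n + 3) (polygon_seed n T d)"

end

theory Submission
  imports Defs
begin

text \<open>
  Grade Laurent polynomials by the vertices of the polygon: the initial variable of a segment from
  \<open>a\<close> to \<open>b\<close> gets degree \<open>e\<^sub>a + e\<^sub>b\<close>, where boundary segments count as well. In the Ptolemy relation for the
  flip of a diagonal, all three products have the degree \<open>e\<^sub>w + e\<^sub>x + e\<^sub>y + e\<^sub>z\<close> of the four corners. Therefore the
  cluster variable of the arc from \<open>a\<close> to \<open>b\<close> is homogeneous of degree \<open>e\<^sub>a + e\<^sub>b\<close>. Each single one of its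
  monomials has this degree and so determines the endpoints of the arc, hence the cluster variable.

  For this argument, every arc needs a well-defined homogeneous Laurent polynomial, independent of the
  sequence of flips that leads to it. This is provided by Plucker coordinates: there are vectors
  \<open>V 0, \<dots>, V (n + 2)\<close> in the plane, with Laurent polynomials as entries, such that the determinant
  of \<open>V a\<close> and \<open>V b\<close> is the initial variable whenever \<open>(a, b)\<close> is an edge of the initial triangulation. They
  are found triangle by triangle, and each new vector only requires a division by an initial variable
  (\<open>apex_vector\<close>, \<open>extend_vectors\<close>). The determinants for all other pairs are then Laurent polynomials, they
  are homogeneous (\<open>homogeneous_plucker\<close>), and they satisfy the Ptolemy relations because these are the
  Plucker relations (\<open>plucker_relation\<close>).

  By induction over mutations, every seed consists of a labelled triangulation, its quiver and the
  determinants of its edges (\<open>plucker_seed_mutate\<close>). This rests on two facts about a flip: the exchanged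
  set is again a triangulation (\<open>flip_triangulation\<close>), and mutation turns the quiver of the old triangulation
  into that of the new one (\<open>arrow_flip\<close>, \<open>mutate_polygon_quiver\<close>). The exchange relation defines the new
  variable by a division, so the old one must be nonzero; this holds because the value at the point
  with all coordinates 1 stays positive.\<close>

section \<open>Edges of a triangulated polygon\<close>

definition edges :: "nat \<Rightarrow> segment set \<Rightarrow> segment set" where
  "edges n T = T \<union> boundary_segments n"

lemma crosses_pair [simp]:
  "crosses (a, b) (c, d) \<longleftrightarrow> a < c \<and> c < b \<and> b < d \<or> c < a \<and> a < d \<and> d < b"
  by (simp add: crosses_def)

text \<open>Maximality is only ever used one segment at a time: no diagonal outside the triangulation
  avoids all of its members.\<close>

lemma triangulation_iff:
  "triangulation n T \<longleftrightarrow> T \<subseteq> diagonals n \<and> noncrossing T \<and>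
     (\<forall>e\<in>diagonals n. (\<forall>f\<in>T. \<not> crosses e f) \<longrightarrow> e \<in> T)"
proof -
  have sym: "crosses e f \<longleftrightarrow> crosses f e" for e f
    by (cases e; cases f) auto
  have irr: "\<not> crosses e e" for e
    by (cases e) auto
  have insert: "noncrossing (insert e T) \<longleftrightarrow> noncrossing T \<and> (\<forall>f\<in>T. \<not> crosses e f)" for e
    unfolding noncrossing_def using sym irr by blast
  show ?thesis
  proof (intro iffI conjI)
    assume T: "triangulation n T"
    show "T \<subseteq> diagonals n" "noncrossing T"
      using T by (simp_all add: triangulation_def)
    show "\<forall>e\<in>diagonals n. (\<forall>f\<in>T. \<not> crosses e f) \<longrightarrow> e \<in> T"
    proof (intro ballI impI)
      fix e assume "e \<in> diagonals n" "\<forall>f\<in>T. \<not> crosses e f"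
      then have "insert e T = T"
        using T insert[of e] unfolding triangulation_def by blast
      then show "e \<in> T" by blast
    qed
  next
    assume *: "T \<subseteq> diagonals n \<and> noncrossing T \<and>
      (\<forall>e\<in>diagonals n. (\<forall>f\<in>T. \<not> crosses e f) \<longrightarrow> e \<in> T)"
    have "T' = T" if "T \<subseteq> T'" "T' \<subseteq> diagonals n" "noncrossing T'" for T'
    proof -
      have "e \<in> T" if "e \<in> T'" for e
      proof -
        have "\<forall>f\<in>T. \<not> crosses e f" "e \<in> diagonals n"
          using \<open>T \<subseteq> T'\<close> \<open>T' \<subseteq> diagonals n\<close> \<open>noncrossing T'\<close> that
          unfolding noncrossing_def by auto
        then show ?thesis using * by blast
      qed
      then show ?thesis using \<open>T \<subseteq> T'\<close> by blast
    qed
    then show "triangulation n T"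
      using * unfolding triangulation_def by blast
  qed
qed

lemma in_diagonals_iff:
  "(a, b) \<in> diagonals n \<longleftrightarrow> a + 1 < b \<and> b < n + 3 \<and> (a, b) \<noteq> (0, n + 2)"
  by (auto simp: diagonals_def boundary_segments_def)

lemma in_boundary_iff:
  "(a, b) \<in> boundary_segments n \<longleftrightarrow> b = a + 1 \<and> b < n + 3 \<or> (a, b) = (0, n + 2)"
  by (auto simp: boundary_segments_def)

lemma diagonal_of_triangulation:
  assumes "triangulation n T" "(a, b) \<in> T"
  shows "a + 1 < b \<and> b < n + 3 \<and> (a, b) \<noteq> (0, n + 2)"
proof -
  have "T \<subseteq> diagonals n"
    using assms(1) unfolding triangulation_def by (elim conjE)
  then have "(a, b) \<in> diagonals n"
    using assms(2) by (rule subsetD)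
  then show ?thesis
    unfolding in_diagonals_iff .
qed

lemma edge_less:
  assumes "triangulation n T" "(a, b) \<in> edges n T"
  shows "a < b" "b < n + 3"
  using assms diagonal_of_triangulation[OF assms(1), of a b] by (auto simp: edges_def in_boundary_iff)

text \<open>One oriented half of \<open>crosses\<close>; the other half arises by exchanging the two edges. In this
  form it feeds linear arithmetic.\<close>

lemma edges_not_interleaved:
  assumes T: "triangulation n T" and e: "(a, b) \<in> edges n T" "(c, d) \<in> edges n T"
  shows "\<not> (a < c \<and> c < b \<and> b < d)"
proof
  assume *: "a < c \<and> c < b \<and> b < d"
  have "b < n + 3" "d < n + 3"
    using edge_less[OF T] e by auto
  then have "(a, b) \<in> T" "(c, d) \<in> T"
    using * e by (auto simp: edges_def in_boundary_iff)
  then show False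
    using T * crosses_pair unfolding triangulation_def noncrossing_def by metis
qed

text \<open>Boundary segments are crossed by nothing, so only the members of \<open>T\<close> can obstruct.\<close>

lemma uncrossed_in_edges:
  assumes T: "triangulation n T" and ab: "a < b" "b < n + 3"
    and "\<And>c d. (c, d) \<in> T \<Longrightarrow> \<not> crosses (a, b) (c, d)"
  shows "(a, b) \<in> edges n T"
proof (cases "(a, b) \<in> diagonals n")
  case True
  have "\<forall>f\<in>T. \<not> crosses (a, b) f"
    using assms(4) by (metis surj_pair)
  then show ?thesis
    using T True unfolding triangulation_iff edges_def by blast
next
  case False
  then show ?thesis
    using ab by (auto simp: edges_def in_diagonals_iff in_boundary_iff)
qed

text \<open>The apex is the largest \<open>c\<close> strictly between \<open>a\<close> and \<open>b\<close> that is joined to \<open>a\<close>. An edge crossing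
  \<open>(c, b)\<close> without crossing \<open>(a, b)\<close> and \<open>(a, c)\<close> would have to start at \<open>a\<close> and end between \<open>c\<close>
  and \<open>b\<close>, against the choice of \<open>c\<close>; so nothing crosses \<open>(c, b)\<close>, and maximality makes it an edge.\<close>

lemma triangle_below:
  assumes T: "triangulation n T" and ab: "(a, b) \<in> edges n T" and "a + 1 < b"
  obtains c where "a < c" "c < b" "(a, c) \<in> edges n T" "(c, b) \<in> edges n T"
proof -
  define C where "C = {c. a < c \<and> c < b \<and> (a, c) \<in> edges n T}"
  have bn: "b < n + 3" by (rule edge_less[OF T ab])
  have "finite C" by (rule finite_subset[of _ "{..<b}"]) (auto simp: C_def)
  moreover have "a + 1 \<in> C"
    using assms(3) bn by (auto simp: C_def edges_def in_boundary_iff)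
  ultimately have c: "Max C \<in> C" and mx: "\<And>x. x \<in> C \<Longrightarrow> x \<le> Max C"
    by (auto intro: Max_in)
  define c where "c = Max C"
  have c: "a < c" "c < b" "(a, c) \<in> edges n T"
    using c by (auto simp: c_def C_def)
  have mx: "q \<le> c" if "a < q" "q < b" "(a, q) \<in> edges n T" for q
    unfolding c_def using that by (intro mx) (simp add: C_def)
  have "(c, b) \<in> edges n T"
  proof (rule uncrossed_in_edges[OF T \<open>c < b\<close> bn])
    fix p q assume pq: "(p, q) \<in> T"
    then have pq': "(p, q) \<in> edges n T" by (simp add: edges_def)
    have "\<not> (a = p \<and> c < q \<and> q < b)"
      using mx[of q] pq' c by force
    then show "\<not> crosses (c, b) (p, q)"
      using edges_not_interleaved[OF T ab pq'] edges_not_interleaved[OF T pq' ab]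
        edges_not_interleaved[OF T c(3) pq'] c by auto
  qed
  with c show thesis by (rule that)
qed

text \<open>The triangle on the far side of \<open>(a, b)\<close> lies below the shortest edge that properly spans
  \<open>(a, b)\<close>: if \<open>(a, b)\<close> were not a side of the triangle below that edge, then one of the two short sides
  would be a shorter edge spanning it.\<close>

lemma triangle_beyond:
  assumes T: "triangulation n T" and ab: "(a, b) \<in> T"
  shows "(\<exists>c>b. (b, c) \<in> edges n T \<and> (a, c) \<in> edges n T) \<or>
         (\<exists>c<a. (c, a) \<in> edges n T \<and> (c, b) \<in> edges n T)"
proof -
  define P where "P = (\<lambda>(p, q). (p, q) \<in> edges n T \<and> p \<le> a \<and> b \<le> q \<and> (p, q) \<noteq> (a, b))"
  have ab': "a + 1 < b" "b < n + 3" "(a, b) \<noteq> (0, n + 2)"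
    using diagonal_of_triangulation[OF T ab] by auto
  \<comment> \<open>the long boundary segment spans everything, so a shortest spanning edge exists\<close>
  have "P (0, n + 2)"
    using ab' by (auto simp: P_def edges_def in_boundary_iff)
  then obtain s where s: "P s" "\<And>t. P t \<Longrightarrow> snd s - fst s \<le> snd t - fst t"
    using ex_has_least_nat[of P "(0, n + 2)" "\<lambda>t. snd t - fst t"] by blast
  obtain p q where pq: "s = (p, q)" by (cases s)
  have P: "(p, q) \<in> edges n T" "p \<le> a" "b \<le> q" "(p, q) \<noteq> (a, b)"
    using s(1) by (auto simp: P_def pq)
  have "p + 1 < q" using P ab' by linarith
  then obtain c where c: "p < c" "c < q" "(p, c) \<in> edges n T" "(c, q) \<in> edges n T"
    using triangle_below[OF T P(1)] by blast
  have ab_edge: "(a, b) \<in> edges n T" using ab by (simp add: edges_def)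
  have "b \<le> c \<or> c \<le> a"
    using edges_not_interleaved[OF T c(3) ab_edge] edges_not_interleaved[OF T ab_edge c(4)] P c
    by (cases "p = a") auto
  then show ?thesis
  proof
    assume "b \<le> c"
    moreover have "\<not> P (p, c)"
      using s(2)[of "(p, c)"] c by (auto simp: pq)
    ultimately have "p = a \<and> c = b"
      using c P by (auto simp: P_def)
    then have "b < q" "(b, q) \<in> edges n T" "(a, q) \<in> edges n T"
      using c P by simp_all
    then show ?thesis by blast
  next
    assume "c \<le> a"
    moreover have "\<not> P (c, q)"
      using s(2)[of "(c, q)"] c by (auto simp: pq)
    ultimately have "c = a \<and> q = b"
      using c P by (auto simp: P_def)
    then have "p < a" "(p, a) \<in> edges n T" "(p, b) \<in> edges n T"
      using c P by simp_all
    then show ?thesis by blast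
  qed
qed

section \<open>Flips\<close>

lemma flip_quadrilateral:
  assumes T: "triangulation n T" and e: "e \<in> T"
  obtains w x y z where "w < x" "x < y" "y < z"
    "{(w, x), (x, y), (y, z), (w, z)} \<subseteq> edges n T" "e = (w, y) \<or> e = (x, z)"
proof -
  obtain a b where ab: "e = (a, b)" by (cases e)
  have "a + 1 < b"
    using diagonal_of_triangulation[OF T, of a b] e ab by simp
  then obtain c where c: "a < c" "c < b" "(a, c) \<in> edges n T" "(c, b) \<in> edges n T"
    using triangle_below[OF T, of a b] e ab by (auto simp: edges_def)
  have "(a, b) \<in> T" using e ab by simp
  from triangle_beyond[OF T this] consider
      f where "b < f" "(b, f) \<in> edges n T" "(a, f) \<in> edges n T"
    | f where "f < a" "(f, a) \<in> edges n T" "(f, b) \<in> edges n T" by blast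
  then show thesis
  proof cases
    case 1
    then show thesis using that[of a c b f] c ab by simp
  next
    case 2
    then show thesis using that[of f a c b] c ab by simp
  qed
qed

text \<open>The quadrilateral determines the flip: a segment that crosses one of its diagonals but none of its
  sides is the other diagonal. Used in both directions this shows that the new diagonal crosses
  only the one that it replaces, and that the exchanged set is again maximal.\<close>

lemma flip_triangulation:
  assumes T: "triangulation n T" and o: "w < x" "x < y" "y < z"
    and sides: "{(w, x), (x, y), (y, z), (w, z)} \<subseteq> edges n T"
    and k: "k \<in> T" "k = (w, y) \<and> k' = (x, z) \<or> k = (x, z) \<and> k' = (w, y)"
  shows "triangulation n (insert k' (T - {k}))" "k' \<in> diagonals n" "k' \<notin> T"
proof -
  note ni = edges_not_interleaved[OF T]
  have zn: "z < n + 3" using edge_less[OF T] sides by auto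
  show k'd: "k' \<in> diagonals n"
    using k o zn by (auto simp: in_diagonals_iff)
  have "crosses k k'" "crosses k' k"
    using k o by auto
  then show "k' \<notin> T"
    using T k(1) unfolding triangulation_def noncrossing_def by blast
  have only_k: "f = k" if f: "f \<in> T" "crosses k' f" for f
  proof -
    obtain p q where pq: "f = (p, q)" by (cases f)
    then have e: "(p, q) \<in> edges n T" using f by (simp add: edges_def)
    have s: "(w, x) \<in> edges n T" "(x, y) \<in> edges n T" "(y, z) \<in> edges n T" "(w, z) \<in> edges n T"
       "k \<in> edges n T"
      using sides k by (auto simp: edges_def)
    show ?thesis
      using f(2) k(2) o edge_less[OF T e] ni[OF s(1) e] ni[OF e s(1)] ni[OF s(2) e] ni[OF e s(2)]
        ni[OF s(3) e] ni[OF e s(3)] ni[OF s(4) e] ni[OF e s(4)]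
      unfolding pq by (elim disjE conjE; simp) linarith+
  qed
  have only_k': "f = k'" if f: "f \<in> diagonals n" "crosses k f"
     "\<forall>g\<in>T-{k}. \<not> crosses f g"  for f
  proof -
    obtain p q where pq: "f = (p, q)" by (cases f)
    have qn: "p < q" "q < n + 3" using f pq by (auto simp: in_diagonals_iff)
    have nc: "\<not> crosses (p, q) s" if "s \<in> edges n T" "s \<noteq> k" for s
    proof (cases "s \<in> T")
      case True
      then show ?thesis using f(3) that pq by blast
    next
      case False
      then show ?thesis using that qn by (cases s) (auto simp: edges_def in_boundary_iff)
    qed
    have "(w, x) \<noteq> k" "(x, y) \<noteq> k" "(y, z) \<noteq> k" "(w, z) \<noteq> k"
      using k o by auto
    then have "\<not> crosses (p, q) (w, x)" "\<not> crosses (p, q) (x, y)" "\<not> crosses (p, q) (y, z)"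
       "\<not> crosses (p, q) (w, z)"
      using nc sides by auto
    then show ?thesis
      using f(2) k(2) o qn
      unfolding pq by (elim disjE conjE; simp) linarith+
  qed
  show "triangulation n (insert k' (T - {k}))"
    unfolding triangulation_iff
  proof (intro conjI ballI impI)
    show "insert k' (T - {k}) \<subseteq> diagonals n"
      using k'd T by (auto simp: triangulation_def)
    have sym: "crosses e f \<longleftrightarrow> crosses f e" for e f
      by (cases e; cases f) auto
    show "noncrossing (insert k' (T - {k}))"
      using T only_k sym k(2) unfolding triangulation_def noncrossing_def by auto
    fix e assume e: "e \<in> diagonals n" and nc: "\<forall>f\<in>insert k' (T - {k}). \<not> crosses e f"
    show "e \<in> insert k' (T - {k})"
    proof (cases "crosses k e")
      case True
      then show ?thesis using only_k' e nc by blast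
    next
      case False
      then have "e \<in> T"
        using T e nc sym unfolding triangulation_iff by blast
      moreover have "e \<noteq> k" using nc \<open>crosses k k'\<close> by blast
      ultimately show ?thesis by blast
    qed
  qed
qed

section \<open>Quivers of triangulations and their mutation\<close>

definition clockwise_sides :: "segment \<Rightarrow> segment \<Rightarrow> segment \<Rightarrow> bool" where
  "clockwise_sides e f g \<longleftrightarrow> (\<exists>a b c. a < b \<and> b < c \<and>
     (e, f, g) \<in> {((a, b), (b, c), (a, c)), ((b, c), (a, c), (a, b)), ((a, c), (a, b), (b, c))})"

lemma clockwise_sides_rotate: "clockwise_sides e f g \<longleftrightarrow> clockwise_sides f g e"
  unfolding clockwise_sides_def by auto

lemma clockwise_sides_third: "clockwise_sides e f g \<Longrightarrow> clockwise_sides e f g' \<Longrightarrow> g = g'"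
  unfolding clockwise_sides_def by auto

lemma clockwise_sides_asym: "clockwise_sides e f g \<Longrightarrow> \<not> clockwise_sides f e g'"
  unfolding clockwise_sides_def by auto

text \<open>Two sides determine the third side of their triangle, so at most one triangle contributes an arrow
  from \<open>e\<close> to \<open>f\<close>: all multiplicities of the quiver of a triangulation are 0 or 1, and the quiver is
  this relation on edges.\<close>

definition arrow :: "segment set \<Rightarrow> segment \<Rightarrow> segment \<Rightarrow> bool" where
  "arrow E e f \<longleftrightarrow> e \<in> E \<and> f \<in> E \<and> (\<exists>g\<in>E. clockwise_sides e f g)"

lemma polygon_quiver_eq:
  "polygon_quiver n T d i j =
     of_bool (i \<in> {1..2 * n + 3} \<and> j \<in> {1..2 * n + 3} \<and> arrow (edges n T) (d i) (d j))"
proof -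
  define S where "S = {t \<in> triangles n T. (d i, d j) \<in> clockwise_cycle t}"
  have uniq: "t = t'" if "t \<in> S" "t' \<in> S" for t t'
  proof -
    obtain a b c a' b' c' where "t = (a, b, c)" "t' = (a', b', c')"
      by (cases t; cases t')
    moreover have "a < b" "b < c" "a' < b'" "b' < c'"
      "(d i, d j) \<in> clockwise_cycle (a, b, c)" "(d i, d j) \<in> clockwise_cycle (a', b', c')"
      using that calculation by (simp_all add: S_def triangles_def)
    ultimately show ?thesis
      unfolding clockwise_cycle_def by auto
  qed
  have "t \<in> S \<Longrightarrow> arrow (edges n T) (d i) (d j)" for t
    unfolding S_def triangles_def clockwise_cycle_def arrow_def clockwise_sides_def
      edges_def[symmetric] by (cases t) auto
  moreover have "\<exists>t. t \<in> S" if arr: "arrow (edges n T) (d i) (d j)"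
  proof -
    obtain g where g: "d i \<in> edges n T" "d j \<in> edges n T" "g \<in> edges n T"
      "clockwise_sides (d i) (d j) g"
      using arr unfolding arrow_def by blast
    from g(4) obtain a b c where abc: "a < b" "b < c"
      "(d i, d j, g) \<in> {((a, b), (b, c), (a, c)), ((b, c), (a, c), (a, b)), ((a, c), (a, b), (b, c))}"
      unfolding clockwise_sides_def by (elim exE conjE) (rule that)
    have "{(a, b), (b, c), (a, c)} \<subseteq> edges n T"
      using g(1-3) abc(3) by (elim insertE; simp)
    then have "(a, b, c) \<in> S"
      using abc unfolding S_def triangles_def clockwise_cycle_def edges_def[symmetric]
      by (simp; elim disjE; simp)
    then show ?thesis by blast
  qed
  ultimately have "S \<noteq> {} \<longleftrightarrow> arrow (edges n T) (d i) (d j)"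
    by blast
  moreover have "card S = of_bool (S \<noteq> {})"
  proof (cases "S = {}")
    case False
    then obtain t where "t \<in> S" by blast
    then have "S = {t}" using uniq by blast
    then show ?thesis by simp
  qed simp
  ultimately have "card S = of_bool (arrow (edges n T) (d i) (d j))"
    by simp
  then show ?thesis
    unfolding polygon_quiver_def S_def[symmetric] by auto
qed

text \<open>All that quiver mutation sees of a flip: around the quadrilateral run the sides
  \<open>s1, s2, s3, s4\<close>, the old diagonal \<open>k\<close> cuts it into the triangles \<open>k, s1, s2\<close> and \<open>k, s3, s4\<close>, and the new
  diagonal \<open>k'\<close> into \<open>k', s2, s3\<close> and \<open>k', s4, s1\<close>, each read clockwise. The sides are indexed cyclically
  so that flipping back, or starting from the other diagonal, has the same form.\<close>

locale flip =
  fixes E E' :: "segment set" and k k' s1 s2 s3 s4 :: segment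
  assumes E': "E' = insert k' (E - {k})"
    and k: "k \<in> E" and k': "k' \<notin> E"
    and sides: "{s1, s2, s3, s4} \<subseteq> E - {k}"
    and dist: "distinct [s1, s2, s3, s4]"
    and tri: "e \<in> E \<Longrightarrow> f \<in> E \<Longrightarrow>
      clockwise_sides k e f \<longleftrightarrow> e = s1 \<and> f = s2 \<or> e = s3 \<and> f = s4"
    and tri': "e \<in> E' \<Longrightarrow> f \<in> E' \<Longrightarrow>
      clockwise_sides k' e f \<longleftrightarrow> e = s2 \<and> f = s3 \<or> e = s4 \<and> f = s1"
begin

lemma in_E': "k' \<in> E'" "{s1, s2, s3, s4} \<subseteq> E'"
  using sides unfolding E' by auto

lemma arrow_from: "arrow E k f \<longleftrightarrow> f = s1 \<or> f = s3"
proof -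
  have "arrow E k f \<longleftrightarrow> f \<in> E \<and> (\<exists>g\<in>E. f = s1 \<and> g = s2 \<or> f = s3 \<and> g = s4)"
    unfolding arrow_def using k by (simp add: tri cong: conj_cong)
  then show ?thesis using sides by auto
qed

lemma arrow_to: "arrow E e k \<longleftrightarrow> e = s2 \<or> e = s4"
proof -
  have "arrow E e k \<longleftrightarrow> e \<in> E \<and> (\<exists>g\<in>E. g = s1 \<and> e = s2 \<or> g = s3 \<and> e = s4)"
    unfolding arrow_def clockwise_sides_rotate[of e k] using k by (simp add: tri cong: conj_cong)
  then show ?thesis using sides by auto
qed

lemma arrow_from': "arrow E' k' f \<longleftrightarrow> f = s2 \<or> f = s4"
proof -
  have "arrow E' k' f \<longleftrightarrow> f \<in> E' \<and> (\<exists>g\<in>E'. f = s2 \<and> g = s3 \<or> f = s4 \<and> g = s1)"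
    unfolding arrow_def using in_E' by (simp add: tri' cong: conj_cong)
  then show ?thesis using in_E' by auto
qed

lemma arrow_to': "arrow E' e k' \<longleftrightarrow> e = s1 \<or> e = s3"
proof -
  have "arrow E' e k' \<longleftrightarrow> e \<in> E' \<and> (\<exists>g\<in>E'. g = s2 \<and> e = s3 \<or> g = s4 \<and> e = s1)"
    unfolding arrow_def clockwise_sides_rotate[of e k'] using in_E' by (simp add: tri' cong: conj_cong)
  then show ?thesis using in_E' by auto
qed

text \<open>The relation \<open>R\<close> collects the arrows from triangles away from the diagonal, which both quivers share.
  The paths through \<open>k\<close> run from \<open>s2\<close> or \<open>s4\<close> to \<open>s1\<close> or \<open>s3\<close>. Two of these four composites cancel the arrows
  \<open>s1 \<rightarrow> s2\<close> and \<open>s3 \<rightarrow> s4\<close> of the two vanishing triangles; the other two are the arrows \<open>s2 \<rightarrow> s3\<close> and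
  \<open>s4 \<rightarrow> s1\<close> of the two new triangles.\<close>

lemma arrow_flip:
  assumes e: "e \<in> E - {k}" and f: "f \<in> E - {k}"
  shows "(of_bool (arrow E' e f) :: nat) =
    (of_bool (arrow E e f) + of_bool (arrow E e k) * of_bool (arrow E k f)) -
    (of_bool (arrow E f e) + of_bool (arrow E f k) * of_bool (arrow E k e))"
proof -
  define R where "R = (\<lambda>e f. \<exists>g\<in>E - {k}. clockwise_sides e f g)"
  have cw: "clockwise_sides k e f \<longleftrightarrow> (e, f) = (s1, s2) \<or> (e, f) = (s3, s4)"
    "clockwise_sides k' e f \<longleftrightarrow> (e, f) = (s2, s3) \<or> (e, f) = (s4, s1)"
    if "e \<in> E - {k}" "f \<in> E - {k}" for e f
    using tri tri' that unfolding E' by auto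
  have arr: "arrow E e f \<longleftrightarrow> R e f \<or> (e, f) = (s1, s2) \<or> (e, f) = (s3, s4)"
    if "e \<in> E - {k}" "f \<in> E - {k}" for e f
  proof -
    have "arrow E e f \<longleftrightarrow> R e f \<or> clockwise_sides k e f"
      using that k clockwise_sides_rotate[of k e f] unfolding arrow_def R_def by blast
    then show ?thesis using cw[OF that] by simp
  qed
  have arr': "arrow E' e f \<longleftrightarrow> R e f \<or> (e, f) = (s2, s3) \<or> (e, f) = (s4, s1)"
  proof -
    have "arrow E' e f \<longleftrightarrow> R e f \<or> clockwise_sides k' e f"
      using e f clockwise_sides_rotate[of k' e f] unfolding arrow_def R_def E' by blast
    then show ?thesis using cw[OF e f] by simp
  qed
  \<comment> \<open>the sides of a triangle on a diagonal span no other triangle, in either orientation\<close>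
  have "\<not> R e f" if "clockwise_sides c e f \<or> clockwise_sides c f e" "c \<notin> E - {k}" for c e f
    using that clockwise_sides_third clockwise_sides_asym clockwise_sides_rotate
    unfolding R_def by metis
  then have R: "(e, f) \<notin> {(s1, s2), (s3, s4), (s2, s3), (s4, s1)} \<and>
     (f, e) \<notin> {(s1, s2), (s3, s4), (s2, s3), (s4, s1)}"
     if "R e f" "e \<in> E - {k}" "f \<in> E - {k}" for e f
    using that cw[OF that(2,3)] cw[OF that(3,2)] k' by blast
  have asym: "R e f \<Longrightarrow> \<not> R f e"
    unfolding R_def using clockwise_sides_asym by blast
  show ?thesis
  proof (cases "R e f \<or> R f e")
    case True
    then have "(e, f) \<notin> {(s1, s2), (s3, s4), (s2, s3), (s4, s1)}"
      "(f, e) \<notin> {(s1, s2), (s3, s4), (s2, s3), (s4, s1)}"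
      using R[OF _ e f] R[OF _ f e] by blast+
    then have "\<not> (arrow E e k \<and> arrow E k f)" "\<not> (arrow E f k \<and> arrow E k e)"
      "arrow E' e f \<longleftrightarrow> R e f" "arrow E e f \<longleftrightarrow> R e f" "arrow E f e \<longleftrightarrow> R f e"
      unfolding arr[OF e f] arr[OF f e] arr' arrow_to arrow_from by blast+
    then show ?thesis
      using True asym by auto
  next
    case False
    then have *: "arrow E' e f \<longleftrightarrow> (e, f) = (s2, s3) \<or> (e, f) = (s4, s1)"
      "arrow E e f \<longleftrightarrow> (e, f) = (s1, s2) \<or> (e, f) = (s3, s4)"
      "arrow E f e \<longleftrightarrow> (f, e) = (s1, s2) \<or> (f, e) = (s3, s4)"
      using arr[OF e f] arr[OF f e] arr' by blast+
    have ne: "s1 \<noteq> s2" "s1 \<noteq> s3" "s1 \<noteq> s4" "s2 \<noteq> s3" "s2 \<noteq> s4" "s3 \<noteq> s4"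
      using dist by simp_all
    consider (fwd) "e \<in> {s2, s4}" "f \<in> {s1, s3}" | (bwd) "f \<in> {s2, s4}" "e \<in> {s1, s3}"
      | (none) "\<not> (e \<in> {s2, s4} \<and> f \<in> {s1, s3})" "\<not> (f \<in> {s2, s4} \<and> e \<in> {s1, s3})"
      by blast
    then show ?thesis
    proof cases
      case fwd
      then have "arrow E e k" "arrow E k f" "\<not> arrow E f k" "\<not> arrow E e f"
        "arrow E' e f \<longleftrightarrow> \<not> arrow E f e"
        unfolding * arrow_to arrow_from using ne by auto
      then show ?thesis by simp
    next
      case bwd
      then have "arrow E f k" "arrow E k e" "\<not> arrow E e k" "\<not> arrow E' e f"
        unfolding * arrow_to arrow_from using ne by auto
      then show ?thesis by simp
    next
      case none
      then have "\<not> arrow E' e f" "\<not> arrow E e f" "\<not> arrow E f e"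
        "\<not> (arrow E e k \<and> arrow E k f)" "\<not> (arrow E f k \<and> arrow E k e)"
        unfolding * arrow_to arrow_from by blast+
      then show ?thesis by simp
    qed
  qed
qed

lemma mutate_polygon_quiver:
  assumes T: "E = edges n T" "E' = edges n T'"
    and d: "bij_betw d {1..2 * n + 3} E" and i: "i \<in> {1..2 * n + 3}" "d i = k"
  shows "mutate_quiver i (polygon_quiver n T d) = polygon_quiver n T' (d(i := k'))"
proof (intro ext)
  fix a b
  define I where "I = {1..2 * n + 3}"
  have dk: "d j \<in> E - {k}" if "j \<in> I" "j \<noteq> i" for j
    using d i that unfolding bij_betw_def inj_on_def I_def by blast
  have loop: "\<not> arrow X e e" for X e
    unfolding arrow_def using clockwise_sides_asym by blast
  have iI: "i \<in> I" using i by (simp add: I_def)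
  have arr: "arrow E' (d j) k' \<longleftrightarrow> arrow E k (d j)"  "arrow E' k' (d j) \<longleftrightarrow> arrow E (d j) k" for j
    unfolding arrow_from arrow_to arrow_from' arrow_to' by (rule refl)+
  have q: "polygon_quiver n T d a b = of_bool (a \<in> I \<and> b \<in> I \<and> arrow E (d a) (d b))" for a b
    unfolding polygon_quiver_eq T I_def ..
  have q': "polygon_quiver n T' (d(i := k')) a b =
      of_bool (a \<in> I \<and> b \<in> I \<and> arrow E' ((d(i := k')) a) ((d(i := k')) b))" for a b
    unfolding polygon_quiver_eq T I_def ..
  consider "a = i" "b = i" | "a = i" "b \<noteq> i" | "a \<noteq> i" "b = i" | "a \<noteq> i" "b \<noteq> i" "a \<in> I \<and> b \<in> I"
    | "a \<noteq> i" "b \<noteq> i" "\<not> (a \<in> I \<and> b \<in> I)" by blast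
  then show "mutate_quiver i (polygon_quiver n T d) a b = polygon_quiver n T' (d(i := k')) a b"
  proof cases
    case 4
    then show ?thesis
      using arrow_flip[OF dk[of a] dk[of b]] iI i(2)
      unfolding mutate_quiver_def q q' by simp
  next
    case 5
    then show ?thesis
      unfolding mutate_quiver_def q q' by auto
  qed (simp_all add: mutate_quiver_def q q' i(2) iI arr loop)
qed

text \<open>The two monomials of the exchange relation at \<open>k\<close> are the products of opposite sides.\<close>

lemma prod_arrows:
  fixes x :: "nat \<Rightarrow> 'f::comm_monoid_mult"
  assumes T: "E = edges n T"
    and d: "bij_betw d {1..2 * n + 3} E" and i: "i \<in> {1..2 * n + 3}" "d i = k"
    and x: "\<And>j. j \<in> {1..2 * n + 3} \<Longrightarrow> x j = X (d j)"
  shows "(\<Prod>j\<in>{1..2 * n + 3}. x j ^ polygon_quiver n T d j i) = X s2 * X s4"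
    "(\<Prod>j\<in>{1..2 * n + 3}. x j ^ polygon_quiver n T d i j) = X s1 * X s3"
proof -
  let ?I = "{1..2 * n + 3}"
  have fin: "finite E" using d bij_betw_finite by blast
  have pick: "(\<Prod>j\<in>?I. X (d j) ^ of_bool (d j = p \<or> d j = q)) = X p * X q"
    if "p \<in> E" "q \<in> E" "p \<noteq> q" for p q
  proof -
    have "(\<Prod>j\<in>?I. X (d j) ^ of_bool (d j = p \<or> d j = q)) = (\<Prod>e\<in>E. X e ^ of_bool (e = p \<or> e = q))"
      by (rule prod.reindex_bij_betw[OF d])
    also have "\<dots> = (\<Prod>e\<in>{p, q}. X e ^ of_bool (e = p \<or> e = q))"
      by (rule prod.mono_neutral_right) (use fin that in auto)
    finally show ?thesis using that by simp
  qed
  have "(\<Prod>j\<in>?I. x j ^ polygon_quiver n T d j i) = (\<Prod>j\<in>?I. X (d j) ^ of_bool (d j = s2 \<or> d j = s4))"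
    using i by (intro prod.cong) (simp_all add: x polygon_quiver_eq T[symmetric] arrow_to)
  then show "(\<Prod>j\<in>?I. x j ^ polygon_quiver n T d j i) = X s2 * X s4"
    using pick[of s2 s4] sides dist by simp
  have "(\<Prod>j\<in>?I. x j ^ polygon_quiver n T d i j) = (\<Prod>j\<in>?I. X (d j) ^ of_bool (d j = s1 \<or> d j = s3))"
    using i by (intro prod.cong) (simp_all add: x polygon_quiver_eq T[symmetric] arrow_from)
  then show "(\<Prod>j\<in>?I. x j ^ polygon_quiver n T d i j) = X s1 * X s3"
    using pick[of s1 s3] sides dist by simp
qed

end

text \<open>An edge has at most one triangle on either side, since two apexes on the same side would make two of
  the four legs cross. Hence the only triangles on a diagonal of the quadrilateral are its two halves.\<close>

lemma clockwise_sides_diagonal: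
  assumes T: "triangulation n T" and o: "w < x" "x < y" "y < z"
    and sides: "{(w, x), (x, y), (y, z), (w, z)} \<subseteq> edges n T"
    and e: "e \<in> edges n T" "f \<in> edges n T"
  shows "clockwise_sides (w, y) e f \<longleftrightarrow>
      (e, f) = ((w, x), (x, y)) \<or> (e, f) = ((y, z), (w, z))" (is ?A)
    and "clockwise_sides (x, z) e f \<longleftrightarrow>
      (e, f) = ((x, y), (y, z)) \<or> (e, f) = ((w, z), (w, x))" (is ?B)
proof -
  note ni = edges_not_interleaved[OF T]
  let ?E = "edges n T"
  have below: "c = c'" if "p < c" "c < q" "(p, c) \<in> ?E" "(c, q) \<in> ?E"
    "p < c'" "c' < q" "(p, c') \<in> ?E" "(c', q) \<in> ?E" for p q c c'
    using that ni[of p c' c q] ni[of p c c' q] by linarith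
  have above: "c = c'" if "p < q" "q < c" "(q, c) \<in> ?E" "(p, c) \<in> ?E"
    "q < c'" "(q, c') \<in> ?E" "(p, c') \<in> ?E" for p q c c'
    using that ni[of p c q c'] ni[of p c' q c] by linarith
  have left: "c = c'" if "p < q" "c < p" "(c, p) \<in> ?E" "(c, q) \<in> ?E"
    "c' < p" "(c', p) \<in> ?E" "(c', q) \<in> ?E" for p q c c'
    using that ni[of c p c' q] ni[of c' p c q] by linarith
  have one_side: False if "p < q" "q < c" "(p, c) \<in> ?E" "c' < p" "(c', q) \<in> ?E" for p q c c'
    using that ni[of c' q p c] by linarith
  obtain a b c d where ef: "e = (a, b)" "f = (c, d)" by (cases e; cases f)
  have s: "(w, x) \<in> ?E" "(x, y) \<in> ?E" "(y, z) \<in> ?E" "(w, z) \<in> ?E"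
    "(a, b) \<in> ?E" "(c, d) \<in> ?E"
    using sides e ef by auto
  have cw: "clockwise_sides (p, q) (a, b) (c, d) \<longleftrightarrow>
     p < q \<and> a = q \<and> q < b \<and> c = p \<and> d = b \<or>
     p < q \<and> b = q \<and> a < p \<and> c = a \<and> d = p \<or>
     a = p \<and> c = b \<and> d = q \<and> p < b \<and> b < q" for p q
    unfolding clockwise_sides_def by auto
  have wy: "w < y" and xz: "x < z" using o by simp_all
  show ?A
  proof
    assume "clockwise_sides (w, y) e f"
    then have "clockwise_sides (w, y) (a, b) (c, d)"
      unfolding ef .
    then show "(e, f) = ((w, x), (x, y)) \<or> (e, f) = ((y, z), (w, z))" (is ?R)
      unfolding cw
    proof (elim disjE conjE)
      assume "a = y" "y < b" "c = w" "d = b"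
      then show ?R unfolding ef using above[OF wy, of b z] o s by simp
    next
      assume "b = y" "a < w" "c = a" "d = w"
      then show ?R using one_side[OF wy o(3) s(4), of a] s by simp
    next
      assume "a = w" "c = b" "d = y" "w < b" "b < y"
      then show ?R unfolding ef using below[of w b y x] o s by simp
    qed
  qed (use o in \<open>auto simp: ef cw\<close>)
  show ?B
  proof
    assume "clockwise_sides (x, z) e f"
    then have "clockwise_sides (x, z) (a, b) (c, d)"
      unfolding ef .
    then show "(e, f) = ((x, y), (y, z)) \<or> (e, f) = ((w, z), (w, x))" (is ?R)
      unfolding cw
    proof (elim disjE conjE)
      assume "a = z" "z < b" "c = x" "d = b"
      then show ?R using one_side[OF xz, of b w] o s by simp
    next
      assume "b = z" "a < x" "c = a" "d = x"
      then show ?R unfolding ef using left[OF xz, of a w] o s by simp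
    next
      assume "a = x" "c = b" "d = z" "x < b" "b < z"
      then show ?R unfolding ef using below[of x b z y] o s by simp
    qed
  qed (use o in \<open>auto simp: ef cw\<close>)
qed

text \<open>The two possible positions of \<open>k\<close> differ by rotating the names of the four sides once.\<close>

lemma obtain_flip:
  assumes T: "triangulation n T" and k: "k \<in> T"
  obtains k' s1 s2 s3 s4 where
    "triangulation n (insert k' (T - {k}))"
    "flip (edges n T) (edges n (insert k' (T - {k}))) k k' s1 s2 s3 s4"
    "\<exists>w x y z. w < x \<and> x < y \<and> y < z \<and>
      ((k, k', s1, s2, s3, s4) = ((w, y), (x, z), (w, x), (x, y), (y, z), (w, z)) \<or>
       (k, k', s1, s2, s3, s4) = ((x, z), (w, y), (x, y), (y, z), (w, z), (w, x)))"
proof -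
  from T k obtain w x y z where q: "w < x" "x < y" "y < z"
    "{(w, x), (x, y), (y, z), (w, z)} \<subseteq> edges n T" "k = (w, y) \<or> k = (x, z)"
    by (rule flip_quadrilateral)
  define k' where "k' = (if k = (w, y) then (x, z) else (w, y))"
  have kk': "k = (w, y) \<and> k' = (x, z) \<or> k = (x, z) \<and> k' = (w, y)"
    using q unfolding k'_def by auto
  let ?T = "insert k' (T - {k})"
  note ft = flip_triangulation[OF T q(1-4) k kk']
  have disj: "k \<notin> boundary_segments n" "k' \<notin> boundary_segments n"
    using T k ft(2) unfolding triangulation_def diagonals_def by auto
  have E': "edges n ?T = insert k' (edges n T - {k})" "k \<in> edges n T" "k' \<notin> edges n T"
    using disj k ft(3) by (auto simp: edges_def)
  have sides: "{(w, x), (x, y), (y, z), (w, z)} \<subseteq> edges n T - {k}"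
    using q by auto
  then have sides': "{(w, x), (x, y), (y, z), (w, z)} \<subseteq> edges n ?T"
    unfolding E' by blast
  note d = clockwise_sides_diagonal[OF T q(1-4)]
  note d' = clockwise_sides_diagonal[OF ft(1) q(1-3) sides']
  from kk' show thesis
  proof
    assume c: "k = (w, y) \<and> k' = (x, z)"
    show thesis
    proof (rule that[OF ft(1)])
      show "flip (edges n T) (edges n ?T) k k' (w, x) (x, y) (y, z) (w, z)"
        using E' sides q(1-3) d(1) d'(2) c by (intro flip.intro) auto
    qed (use c q(1-3) in auto)
  next
    assume c: "k = (x, z) \<and> k' = (w, y)"
    show thesis
    proof (rule that[OF ft(1)])
      show "flip (edges n T) (edges n ?T) k k' (x, y) (y, z) (w, z) (w, x)"
        using E' sides q(1-3) d(2) d'(1) c by (intro flip.intro) auto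
    qed (use c q(1-3) in auto)
  qed
qed

section \<open>Laurent polynomials and Plucker coordinates\<close>

text \<open>The value at the point where every variable is 1. It witnesses that cluster variables do
  not vanish: as a ring homomorphism to the integers it is positive on the initial variables, and the
  exchange relation propagates positivity, although it involves a division.\<close>

definition augmentation :: "laurent \<Rightarrow> int" where
  "augmentation p = (\<Sum>m\<in>Poly_Mapping.keys p. Poly_Mapping.lookup p m)"

lemma augmentation_single [simp]: "augmentation (Poly_Mapping.single m c) = c"
  by (simp add: augmentation_def)

lemma augmentation_add: "augmentation (p + q) = augmentation p + augmentation q"
  unfolding augmentation_def by (rule setsum_keys_plus_distrib) auto

lemma augmentation_diff: "augmentation (p - q) = augmentation p - augmentation q"
  using augmentation_add[of "p - q" q] by simp

lemma augmentation_mult: "augmentation (p * q) = augmentation p * augmentation q"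
proof -
  have "Poly_Mapping.keys p \<subseteq> UNIV" by simp
  then show ?thesis
  proof (induction p rule: frag_induction)
    case (one a)
    have "Poly_Mapping.keys q \<subseteq> UNIV" by simp
    then show ?case
    proof (induction q rule: frag_induction)
      case (diff p q)
      then show ?case by (simp add: augmentation_diff right_diff_distrib)
    qed (auto simp: mult_single augmentation_def)
  next
    case (diff p' q')
    then show ?case by (simp add: augmentation_diff left_diff_distrib)
  qed (simp add: augmentation_def)
qed

lemma of_laurent_add: "of_laurent (p + q) = of_laurent p + of_laurent q"
  by (simp add: of_laurent_def)

lemma of_laurent_mult: "of_laurent (p * q) = of_laurent p * of_laurent q"
  by (simp add: of_laurent_def)

lemma of_laurent_eq_0_iff: "of_laurent p = 0 \<longleftrightarrow> p = 0"
  by (simp add: of_laurent_def Zero_fract_def eq_fract)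

text \<open>The minors of a \<open>2 \<times> N\<close> matrix, given by its columns \<open>V i\<close>.\<close>

definition plucker :: "(nat \<Rightarrow> laurent \<times> laurent) \<Rightarrow> segment \<Rightarrow> laurent" where
  "plucker V = (\<lambda>(a, b). fst (V a) * snd (V b) - fst (V b) * snd (V a))"

text \<open>With \<open>w < x < y < z\<close> as corners of a quadrilateral, this is the exchange relation of its flip.\<close>

lemma plucker_relation:
  "plucker V (w, y) * plucker V (x, z) =
     plucker V (w, x) * plucker V (y, z) + plucker V (x, y) * plucker V (w, z)"
  by (simp add: plucker_def algebra_simps)

section \<open>The vertex grading\<close>

text \<open>The degree of the segment \<open>e\<close> in the grading by vertices: the sum of the unit vectors of its two
  endpoints.\<close>

definition incidence :: "segment \<Rightarrow> nat \<Rightarrow> int" where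
  "incidence e v = of_bool (fst e = v) + of_bool (snd e = v)"

lemma incidence_inject:
  assumes "incidence (a, b) = incidence (c, d)" "a < b" "c < d"
  shows "(a, b) = (c, d)"
proof -
  have *: "of_bool (a = v) + of_bool (b = v) = (of_bool (c = v) + of_bool (d = v) :: int)" for v
    using fun_cong[OF assms(1), of v] by (simp add: incidence_def)
  have "a = c \<or> a = d" "b = c \<or> b = d" "c = a \<or> c = b"
    using *[of a] *[of b] *[of c] assms(2,3) by (auto split: if_splits simp: of_bool_def)
  then show ?thesis using assms(2,3) by auto
qed

locale triangulated_polygon =
  fixes n :: nat and T :: "segment set" and d :: "nat \<Rightarrow> segment"
  assumes T: "triangulation n T" and lab: "labelling n T d"
begin

abbreviation E where "E \<equiv> edges n T"
abbreviation I where "I \<equiv> {1..2 * n + 3}"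

lemma bij_labels: "bij_betw d I E"
proof -
  have "T \<inter> boundary_segments n = {}"
    using T unfolding triangulation_def diagonals_def by auto
  then have "bij_betw d ({1..n} \<union> {n + 1..2 * n + 3}) (T \<union> boundary_segments n)"
    using lab unfolding labelling_def by (intro bij_betw_combine) auto
  moreover have "{1..n} \<union> {n + 1..2 * n + 3} = I" by auto
  ultimately show ?thesis by (simp add: edges_def)
qed

definition vertex_degree :: "laurent_monomial \<Rightarrow> nat \<Rightarrow> int" where
  "vertex_degree m v = (\<Sum>i\<in>I. Poly_Mapping.lookup m i * incidence (d i) v)"

definition homogeneous :: "laurent \<Rightarrow> (nat \<Rightarrow> int) \<Rightarrow> bool" where
  "homogeneous p g \<longleftrightarrow> (\<forall>m\<in>Poly_Mapping.keys p. \<forall>v. vertex_degree m v = g v)"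

lemma vertex_degree_add: "vertex_degree (m + m') v = vertex_degree m v + vertex_degree m' v"
  by (simp add: vertex_degree_def lookup_add distrib_right sum.distrib)

lemma vertex_degree_single: "i \<in> I \<Longrightarrow> vertex_degree (Poly_Mapping.single i c) v = c * incidence (d i) v"
proof -
  assume i: "i \<in> I"
  have "vertex_degree (Poly_Mapping.single i c) v = (\<Sum>j\<in>I. if i = j then c * incidence (d j) v else 0)"
    unfolding vertex_degree_def by (intro sum.cong) (auto simp: lookup_single when_def)
  also have "\<dots> = c * incidence (d i) v" using i by simp
  finally show ?thesis .
qed

lemma homogeneous_zero: "homogeneous 0 g"
  by (simp add: homogeneous_def)

lemma homogeneous_one: "homogeneous 1 (\<lambda>v. 0)"
  by (simp add: homogeneous_def vertex_degree_def)

lemma homogeneous_add: "homogeneous p g \<Longrightarrow> homogeneous q g \<Longrightarrow> homogeneous (p + q) g"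
  using keys_add[of p q] unfolding homogeneous_def by blast

lemma homogeneous_diff: "homogeneous p g \<Longrightarrow> homogeneous q g \<Longrightarrow> homogeneous (p - q) g"
  using keys_diff[of p q] unfolding homogeneous_def by blast

lemma homogeneous_mult:
  "homogeneous p g \<Longrightarrow> homogeneous q h \<Longrightarrow> homogeneous (p * q) (\<lambda>v. g v + h v)"
  using keys_mult[of p q] unfolding homogeneous_def by (fastforce simp: vertex_degree_add)

definition edge_power :: "segment \<Rightarrow> int \<Rightarrow> laurent" where
  "edge_power e c = Poly_Mapping.single (Poly_Mapping.single (inv_into I d e) c) 1"

lemma edge_power_inverse: "edge_power e (- 1) * edge_power e 1 = 1"
  by (simp add: edge_power_def mult_single flip: single_add)

lemma homogeneous_edge_power:
  assumes "e \<in> E"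
  shows "homogeneous (edge_power e c) (\<lambda>v. c * incidence e v)"
proof -
  have "inv_into I d e \<in> I" "d (inv_into I d e) = e"
    using assms bij_labels by (simp_all only: bij_betw_def inv_into_into f_inv_into_f)
  then show ?thesis
    by (simp add: homogeneous_def edge_power_def vertex_degree_single)
qed

text \<open>The initial columns at \<open>0\<close> and \<open>n + 2\<close> are \<open>(1, 0)\<close> and \<open>(0, x)\<close>, where \<open>x\<close> is the variable of the
  segment \<open>(0, n + 2)\<close>, so the entries of \<open>V i\<close> cannot both have the degree of vertex \<open>i\<close>. The opposite shifts
  by vertex \<open>0\<close> in the two rows accommodate these columns and cancel in every minor.\<close>

definition graded :: "(nat \<Rightarrow> laurent \<times> laurent) \<Rightarrow> nat \<Rightarrow> bool" where
  "graded V i \<longleftrightarrow> homogeneous (fst (V i)) (\<lambda>v. of_bool (i = v) - of_bool (0 = v)) \<and>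
     homogeneous (snd (V i)) (\<lambda>v. of_bool (i = v) + of_bool (0 = v))"

text \<open>Both products in the minor pair an entry of one row with an entry of the other, so the shifts by
  vertex \<open>0\<close> cancel. Hence every monomial of a minor remembers the two indices.\<close>

lemma homogeneous_plucker:
  assumes "graded V a" "graded V b"
  shows "homogeneous (plucker V (a, b)) (incidence (a, b))"
proof -
  have "homogeneous (fst (V a) * snd (V b)) (incidence (a, b))"
    "homogeneous (fst (V b) * snd (V a)) (incidence (a, b))"
    using homogeneous_mult[of "fst (V a)" _ "snd (V b)"] homogeneous_mult[of "fst (V b)" _ "snd (V a)"]
      assms unfolding graded_def by (fastforce simp: incidence_def[abs_def] algebra_simps)+
  then show ?thesis
    by (simp add: plucker_def homogeneous_diff)
qed

text \<open>The column of the apex of a triangle over \<open>(a, b)\<close> is forced by Cramer's rule: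
  \<open>x(a, b) * V c = x(c, b) * V a + x(a, c) * V b\<close>. Dividing by the initial variable \<open>x(a, b)\<close> stays within
  Laurent polynomials; that no other division occurs is what makes all minors Laurent polynomials.\<close>

lemma apex_vector:
  assumes E: "(a, b) \<in> E" "(a, c) \<in> E" "(c, b) \<in> E"
    and ab: "plucker V (a, b) = edge_power (a, b) 1" and gr: "graded V a" "graded V b"
    and c: "c \<noteq> a" "c \<noteq> b"
  obtains z where "plucker (V(c := z)) (a, c) = edge_power (a, c) 1"
    "plucker (V(c := z)) (c, b) = edge_power (c, b) 1" "graded (V(c := z)) c"
proof -
  define comb where "comb = (\<lambda>p q. edge_power (a, b) (- 1) *
     (edge_power (c, b) 1 * p + edge_power (a, c) 1 * q))"
  define z where "z = (comb (fst (V a)) (fst (V b)), comb (snd (V a)) (snd (V b)))"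
  have unit: "edge_power (a, b) (- 1) * plucker V (a, b) = 1"
    unfolding ab by (rule edge_power_inverse)
  have "plucker (V(c := z)) (a, c) =
      edge_power (a, c) 1 * (edge_power (a, b) (- 1) * plucker V (a, b))"
    using c by (simp add: plucker_def z_def comb_def algebra_simps)
  moreover have "plucker (V(c := z)) (c, b) =
      edge_power (c, b) 1 * (edge_power (a, b) (- 1) * plucker V (a, b))"
    using c by (simp add: plucker_def z_def comb_def algebra_simps)
  moreover have comb: "homogeneous (comb p q) (\<lambda>v. of_bool (c = v) + h v)"
    if "homogeneous p (\<lambda>v. of_bool (a = v) + h v)" "homogeneous q (\<lambda>v. of_bool (b = v) + h v)" for p q h
  proof -
    let ?g = "\<lambda>v. of_bool (a = v) + of_bool (b = v) + of_bool (c = v) + h v"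
    have "homogeneous (edge_power (c, b) 1 * p) ?g"
      using homogeneous_mult[OF homogeneous_edge_power[OF E(3), of 1] that(1)]
      by (simp add: incidence_def algebra_simps)
    moreover have "homogeneous (edge_power (a, c) 1 * q) ?g"
      using homogeneous_mult[OF homogeneous_edge_power[OF E(2), of 1] that(2)]
      by (simp add: incidence_def algebra_simps)
    ultimately have "homogeneous (edge_power (c, b) 1 * p + edge_power (a, c) 1 * q) ?g"
      by (rule homogeneous_add)
    from homogeneous_mult[OF homogeneous_edge_power[OF E(1), of "- 1"] this]
    show ?thesis
      by (simp add: comb_def incidence_def algebra_simps)
  qed
  have "graded (V(c := z)) c"
    using comb[of "fst (V a)" "\<lambda>v. - of_bool (0 = v)" "fst (V b)"]
      comb[of "snd (V a)" "\<lambda>v. of_bool (0 = v)" "snd (V b)"] gr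
    by (simp add: graded_def z_def)
  ultimately show thesis
    using unit by (intro that[of z]) simp_all
qed

text \<open>Recursion over the triangles below \<open>(a, b)\<close>: after choosing the column at the apex \<open>c\<close>, the two
  sides \<open>(a, c)\<close> and \<open>(c, b)\<close> are treated independently. Among the edges between
  vertices from \<open>a\<close> to \<open>b\<close>, only \<open>(a, b)\<close> passes over \<open>c\<close>, so the two solutions can be glued at \<open>c\<close>.\<close>

lemma extend_vectors:
  assumes "(a, b) \<in> E" "plucker V (a, b) = edge_power (a, b) 1" "graded V a" "graded V b"
  shows "\<exists>W. W a = V a \<and> W b = V b \<and> (\<forall>i\<in>{a..b}. graded W i) \<and>
    (\<forall>p q. (p, q) \<in> E \<and> a \<le> p \<and> q \<le> b \<longrightarrow> plucker W (p, q) = edge_power (p, q) 1)"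
  using assms
proof (induction "b - a" arbitrary: a b V rule: less_induct)
  case less
  have ab: "a < b" using edge_less[OF T less.prems(1)] by simp
  show ?case
  proof (cases "b = a + 1")
    case True
    have "p = a \<and> q = b" if "(p, q) \<in> E" "a \<le> p" "q \<le> b" for p q
      using edge_less[OF T that(1)] that True by linarith
    moreover have "{a..b} = {a, b}" using True by auto
    ultimately show ?thesis using less.prems by (intro exI[of _ V]) auto
  next
    case False
    then have "a + 1 < b" using ab by linarith
    then obtain c where c: "a < c" "c < b" "(a, c) \<in> E" "(c, b) \<in> E"
      by (rule triangle_below[OF T less.prems(1)])
    have ne: "c \<noteq> a" "c \<noteq> b" using c by auto
    obtain z where z: "plucker (V(c := z)) (a, c) = edge_power (a, c) 1"
        "plucker (V(c := z)) (c, b) = edge_power (c, b) 1" "graded (V(c := z)) c"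
      by (rule apex_vector[OF less.prems(1) c(3,4) less.prems(2-4) ne])
    have gr: "graded (V(c := z)) a" "graded (V(c := z)) b"
      using less.prems ne by (simp_all add: graded_def)
    obtain A where A: "A a = V a" "A c = z" "\<forall>i\<in>{a..c}. graded A i"
       "\<forall>p q. (p, q) \<in> E \<and> a \<le> p \<and> q \<le> c \<longrightarrow> plucker A (p, q) = edge_power (p, q) 1"
      using less.hyps[OF _ c(3) z(1) gr(1) z(3)] c ne by (simp add: diff_less_mono) blast
    obtain B where B: "B c = z" "B b = V b" "\<forall>i\<in>{c..b}. graded B i"
       "\<forall>p q. (p, q) \<in> E \<and> c \<le> p \<and> q \<le> b \<longrightarrow> plucker B (p, q) = edge_power (p, q) 1"
      using less.hyps[OF _ c(4) z(2) z(3) gr(2)] c ne by (simp add: diff_less_mono2) blast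
    define W where "W = (\<lambda>i. if i \<le> c then A i else B i)"
    have WA: "W i = A i" if "i \<le> c" for i using that by (simp add: W_def)
    have WB: "W i = B i" if "c \<le> i" for i using that A(2) B(1) by (simp add: W_def)
    have "plucker W (p, q) = edge_power (p, q) 1" if pq: "(p, q) \<in> E" "a \<le> p" "q \<le> b" for p q
    proof -
      have less_pq: "p < q" using edge_less[OF T pq(1)] by simp
      consider "q \<le> c" | "c \<le> p" | "p < c" "c < q" by linarith
      then show ?thesis
      proof cases
        case 1
        then have "plucker W (p, q) = plucker A (p, q)"
          using less_pq by (simp add: plucker_def WA)
        then show ?thesis using A(4) pq 1 by simp
      next
        case 2
        then have "plucker W (p, q) = plucker B (p, q)"
          using less_pq by (simp add: plucker_def WB)
        then show ?thesis using B(4) pq 2 by simp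
      next
        case 3
        have "p = a"
          using edges_not_interleaved[OF T c(3) pq(1)] 3 pq by linarith
        moreover have "q = b"
          using edges_not_interleaved[OF T pq(1) c(4)] 3 pq by linarith
        moreover have "plucker W (a, b) = plucker V (a, b)"
          using WA[of a] WB[of b] A(1) B(2) c by (simp add: plucker_def)
        ultimately show ?thesis using less.prems(2) by simp
      qed
    qed
    moreover have "graded W i" if "i \<in> {a..b}" for i
    proof (cases "i \<le> c")
      case True
      then show ?thesis using A(3) that WA[of i] by (simp add: graded_def)
    next
      case False
      then show ?thesis using B(3) that WB[of i] by (simp add: graded_def)
    qed
    moreover have "W a = V a" "W b = V b"
      using WA[of a] WB[of b] A(1) B(2) c by simp_all
    ultimately show ?thesis by blast
  qed
qed

lemma ex_vectors:
  "\<exists>V. (\<forall>i<n + 3. graded V i) \<and> (\<forall>e\<in>E. plucker V e = edge_power e 1)"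
proof -
  let ?N = "n + 2"
  have e: "(0, ?N) \<in> E" by (simp add: edges_def in_boundary_iff)
  define V :: "nat \<Rightarrow> laurent \<times> laurent" where
    "V = (\<lambda>i. if i = 0 then (1, 0) else (0, edge_power (0, ?N) 1))"
  have "plucker V (0, ?N) = edge_power (0, ?N) 1"
    by (simp add: plucker_def V_def)
  moreover have "graded V 0"
    using homogeneous_one by (simp add: graded_def V_def homogeneous_zero)
  moreover have "graded V ?N"
    using homogeneous_edge_power[OF e, of 1]
    by (simp add: graded_def V_def homogeneous_zero incidence_def algebra_simps)
  ultimately obtain W where W: "\<forall>i\<in>{0..?N}. graded W i"
    "\<forall>p q. (p, q) \<in> E \<and> q \<le> ?N \<longrightarrow> plucker W (p, q) = edge_power (p, q) 1"
    using extend_vectors[OF e, of V] by auto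
  have "plucker W e = edge_power e 1" if "e \<in> E" for e
    using W(2) edge_less(2)[OF T, of "fst e" "snd e"] that by (cases e) auto
  moreover have "graded W i" if "i < n + 3" for i
    using W(1) that by simp
  ultimately show ?thesis by blast
qed

end

section \<open>Seeds as triangulations\<close>

lemma bij_betw_fun_upd_swap:
  assumes "bij_betw f A B" "a \<in> A" "b \<notin> B"
  shows "bij_betw (f(a := b)) A (insert b (B - {f a}))"
proof -
  have "inj_on (f(a := b)) A" "f(a := b) ` A = insert b (B - {f a})"
    using assms unfolding bij_betw_def inj_on_def by auto
  then show ?thesis by (simp add: bij_betw_def)
qed

text \<open>The mutation invariant: up to irrelevant labels, the seed is the one attached to some labelled
  triangulation by the fixed columns \<open>V\<close>. Only the triangulation and its labelling change under mutation.
  Positivity of the augmentations is carried along because mutation divides by a cluster variable.\<close>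

definition plucker_seed :: "nat \<Rightarrow> (nat \<Rightarrow> laurent \<times> laurent) \<Rightarrow> ratfun seed \<Rightarrow> bool" where
  "plucker_seed n V s \<longleftrightarrow> (\<exists>T d. triangulation n T \<and>
     bij_betw d {1..2 * n + 3} (edges n T) \<and> d ` {1..n} \<subseteq> T \<and> snd s = polygon_quiver n T d \<and>
     (\<forall>i\<in>{1..2 * n + 3}. fst s i = of_laurent (plucker V (d i)) \<and>
        0 < augmentation (plucker V (d i))))"

lemma plucker_seed_mutate:
  assumes "plucker_seed n V s" "k \<in> {1..n}"
  shows "plucker_seed n V (mutate_seed (2 * n + 3) k s)"
proof -
  let ?I = "{1..2 * n + 3}"
  let ?P = "plucker V"
  obtain x q where s: "s = (x, q)" by (cases s)
  obtain T d where T: "triangulation n T" and d: "bij_betw d ?I (edges n T)" "d ` {1..n} \<subseteq> T"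
    and q: "q = polygon_quiver n T d"
    and x: "\<And>i. i \<in> ?I \<Longrightarrow> x i = of_laurent (?P (d i))"
    and pos: "\<And>i. i \<in> ?I \<Longrightarrow> 0 < augmentation (?P (d i))"
    using assms(1) unfolding plucker_seed_def s by auto
  have kI: "k \<in> ?I" "d k \<in> T" using assms(2) d(2) by auto
  obtain e s1 s2 s3 s4 where T': "triangulation n (insert e (T - {d k}))"
    and flip: "flip (edges n T) (edges n (insert e (T - {d k}))) (d k) e s1 s2 s3 s4"
    and quad: "\<exists>w x y z. w < x \<and> x < y \<and> y < z \<and>
      ((d k, e, s1, s2, s3, s4) = ((w, y), (x, z), (w, x), (x, y), (y, z), (w, z)) \<or>
       (d k, e, s1, s2, s3, s4) = ((x, z), (w, y), (x, y), (y, z), (w, z), (w, x)))"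
    by (rule obtain_flip[OF T kI(2)])
  interpret flip "edges n T" "edges n (insert e (T - {d k}))" "d k" e s1 s2 s3 s4
    by (rule flip)
  have ptolemy: "?P (d k) * ?P e = ?P s2 * ?P s4 + ?P s1 * ?P s3"
  proof -
    obtain w x y z where
      "(d k, e, s1, s2, s3, s4) = ((w, y), (x, z), (w, x), (x, y), (y, z), (w, z)) \<or>
       (d k, e, s1, s2, s3, s4) = ((x, z), (w, y), (x, y), (y, z), (w, z), (w, x))"
      using quad by blast
    then show ?thesis
      using plucker_relation[of V w y x z] by (elim disjE) (simp_all add: ac_simps)
  qed
  have pos_edge: "0 < augmentation (?P f)" if "f \<in> edges n T" for f
  proof -
    have "f \<in> d ` ?I" using that bij_betw_imp_surj_on[OF d(1)] by simp
    then obtain i where "i \<in> ?I" "f = d i" by (elim imageE)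
    then show ?thesis using pos by blast
  qed
  have pos_k: "0 < augmentation (?P (d k))" using kI(1) by (rule pos)
  have "0 < augmentation (?P (d k)) * augmentation (?P e)"
    unfolding augmentation_mult[symmetric] ptolemy
    unfolding augmentation_mult augmentation_add using pos_edge sides by (simp add: add_pos_pos)
  then have pos_e: "0 < augmentation (?P e)"
    using pos_k by (rule zero_less_mult_pos)
  have nz: "of_laurent (?P (d k)) \<noteq> 0"
    using pos_k by (auto simp: of_laurent_eq_0_iff augmentation_def)
  have new: "((\<Prod>i\<in>?I. x i ^ q i k) + (\<Prod>i\<in>?I. x i ^ q k i)) / x k = of_laurent (?P e)"
  proof -
    have "(\<Prod>i\<in>?I. x i ^ q i k) + (\<Prod>i\<in>?I. x i ^ q k i) = of_laurent (?P (d k) * ?P e)"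
      unfolding q ptolemy of_laurent_add of_laurent_mult
      using prod_arrows[OF refl d(1) kI(1) refl, of x "\<lambda>f. of_laurent (?P f)"] x by simp
    then show ?thesis
      using nz by (simp add: x[OF kI(1)] of_laurent_mult)
  qed
  have d': "bij_betw (d(k := e)) ?I (edges n (insert e (T - {d k})))"
    unfolding E' by (rule bij_betw_fun_upd_swap[OF d(1) kI(1) k'])
  have "(d(k := e)) ` {1..n} \<subseteq> insert e (T - {d k})"
  proof
    fix f assume "f \<in> (d(k := e)) ` {1..n}"
    then obtain i where i: "i \<in> {1..n}" "f = (d(k := e)) i" by blast
    have "i \<in> ?I" using i(1) by simp
    then have "d i = d k \<longleftrightarrow> i = k"
      using bij_betw_imp_inj_on[OF d(1)] kI(1) by (simp only: inj_on_eq_iff)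
    moreover have "d i \<in> T" using i(1) d(2) by blast
    ultimately show "f \<in> insert e (T - {d k})"
      using i(2) by (cases "i = k") simp_all
  qed
  moreover have "mutate_seed (2 * n + 3) k s =
      (x(k := of_laurent (?P e)), polygon_quiver n (insert e (T - {d k})) (d(k := e)))"
    unfolding s mutate_seed_def prod.case new
    unfolding q by (simp only: mutate_polygon_quiver[OF refl refl d(1) kI(1) refl])
  moreover have "\<forall>i\<in>?I. (x(k := of_laurent (?P e))) i = of_laurent (?P ((d(k := e)) i)) \<and>
      0 < augmentation (?P ((d(k := e)) i))"
    using x pos pos_e by simp
  ultimately show ?thesis
    unfolding plucker_seed_def using T' d' by (metis fst_conv snd_conv)
qed

context triangulated_polygon
begin

lemma cluster_variables_plucker:
  "\<exists>V. (\<forall>i<n + 3. graded V i) \<and> (\<forall>u\<in>polygon_cluster_variables n T d.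
      \<exists>a b. a < b \<and> b < n + 3 \<and> u = of_laurent (plucker V (a, b)))"
proof -
  obtain V where V: "\<forall>i<n + 3. graded V i" "\<forall>e\<in>E. plucker V e = edge_power e 1"
    using ex_vectors by blast
  have init: "plucker_seed n V (polygon_seed n T d)"
    unfolding plucker_seed_def
  proof (intro exI conjI ballI)
    show "triangulation n T" "bij_betw d I (edges n T)"
      by (rule T) (rule bij_labels)
    show "d ` {1..n} \<subseteq> T"
      using lab by (simp add: labelling_def bij_betw_def)
    show "snd (polygon_seed n T d) = polygon_quiver n T d"
      by (simp add: polygon_seed_def)
    fix i assume i: "i \<in> I"
    have "d i \<in> E" "inv_into I d (d i) = i"
      using bij_betwE[OF bij_labels] bij_betw_inv_into_left[OF bij_labels i] i by blast+
    then have "plucker V (d i) = Poly_Mapping.single (Poly_Mapping.single i 1) 1"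
      using V(2) by (simp only: edge_power_def)
    then show "fst (polygon_seed n T d) i = of_laurent (plucker V (d i))"
      "0 < augmentation (plucker V (d i))"
      by (simp_all add: polygon_seed_def var_def)
  qed
  have seeds: "plucker_seed n V s" if "s \<in> seeds n (2 * n + 3) (polygon_seed n T d)" for s
    using that
  proof (induction rule: seeds.induct)
    case initial
    show ?case by (rule init)
  next
    case (mutate s k)
    show ?case by (rule plucker_seed_mutate[OF mutate.IH mutate.hyps(2)])
  qed
  show ?thesis
  proof (intro exI[of _ V] conjI ballI V(1))
    fix u assume "u \<in> polygon_cluster_variables n T d"
    then obtain s k where s: "s \<in> seeds n (2 * n + 3) (polygon_seed n T d)" "k \<in> {1..n}" "u = fst s k"
      unfolding polygon_cluster_variables_def cluster_variables_def by blast
    obtain T' d' where T': "triangulation n T'" "d' ` {1..n} \<subseteq> T'"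
      "\<forall>i\<in>I. fst s i = of_laurent (plucker V (d' i))"
      using seeds[OF s(1)] unfolding plucker_seed_def by blast
    obtain a b where ab: "d' k = (a, b)" by (cases "d' k")
    have "d' k \<in> T'" using T'(2) s(2) by blast
    then have "(a, b) \<in> T'" by (simp only: ab)
    then have "a < b" "b < n + 3"
      using diagonal_of_triangulation[OF T'(1)] by fastforce+
    moreover have "u = of_laurent (plucker V (a, b))"
      using T'(3) s ab by auto
    ultimately show "\<exists>a b. a < b \<and> b < n + 3 \<and> u = of_laurent (plucker V (a, b))"
      by blast
  qed
qed

end

section \<open>Common monomials of cluster variables\<close>

theorem corollary10p2:
  fixes n :: nat and T :: "segment set" and d :: "nat \<Rightarrow> segment" and u v :: ratfun
  assumes "n \<ge> 1"
    and "triangulation n T"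
    and "labelling n T d"
    and "u \<in> polygon_cluster_variables n T d"
    and "v \<in> polygon_cluster_variables n T d"
    and "laurent_monomials u \<inter> laurent_monomials v \<noteq> {}"
  shows "u = v"
proof -
  interpret triangulated_polygon n T d
    by unfold_locales (fact assms)+
  obtain V where gr: "\<forall>i<n + 3. graded V i"
    and V: "\<forall>u\<in>polygon_cluster_variables n T d.
      \<exists>a b. a < b \<and> b < n + 3 \<and> u = of_laurent (plucker V (a, b))"
    using cluster_variables_plucker by blast
  obtain a b where u: "a < b" "b < n + 3" "u = of_laurent (plucker V (a, b))"
    using V assms(4) by blast
  obtain a' b' where v: "a' < b'" "b' < n + 3" "v = of_laurent (plucker V (a', b'))"
    using V assms(5) by blast
  obtain m where m: "m \<in> laurent_monomials u" "m \<in> laurent_monomials v"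
    using assms(6) by blast
  have "vertex_degree m = incidence (a, b)"
    using m(1) homogeneous_plucker[of V a b] gr u
    by (auto simp: laurent_monomials_def homogeneous_def)
  moreover have "vertex_degree m = incidence (a', b')"
    using m(2) homogeneous_plucker[of V a' b'] gr v
    by (auto simp: laurent_monomials_def homogeneous_def)
  ultimately have "(a, b) = (a', b')"
    using u v by (intro incidence_inject) auto
  then show "u = v" using u v by simp
qed

end
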